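(* Let $\mathbf{f}\in L^\infty(0,T;H^{-1}(\Omega))$. Then for all $\Delta t>0$ and $N\ge1$, any solution $(\mathbf{u}_h^{n+1},P_h^{n+1})_{0\le n\le N-1}$ of the time-filtered backward Euler EMAC algorithm described in the context is unconditionally stable in the following sense: $$\|\mathbf{u}_h^N\|^2+\frac13\sum_{n=1}^{N-1}\|\mathbf{u}_h^{n+1}-2\mathbf{u}_h^n+\mathbf{u}_h^{n-1}\|_F^2+\frac{2\Delta t\,\nu}{3}\sum_{n=1}^{N-1}\|\nabla F[\mathbf{u}_h^{n+1}]\|^2$$ $$\le\Big(\frac13\Big)^N\|\mathbf{u}_h^0\|^2+2N\big(\|\mathbf{u}_h^1\|^2+\|\mathbf{u}_h^0\|^2\big)+\frac{2N\Delta t\,\nu^{-1}}{3}\sum_{n=1}^{N-1}\|\mathbf{f}(t^{n+1})\|_{-1}^2 .$$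
   Context: Domain and spaces: $\Omega\subset\mathbb{R}^d$, $d\in\{2,3\}$, is a convex polygonal or polyhedral domain; $(\cdot,\cdot)$ and $\|\cdot\|$ are the $L^2(\Omega)$ inner product and norm (also used for the duality pairing); $\mathbf{X}=(H_0^1(\Omega))^d$, $Q=L_0^2(\Omega)$; $H^{-1}(\Omega)$ is the dual of $\mathbf{X}$ with norm $\|\mathbf{f}\|_{-1}=\sup_{0\neq\mathbf{v}\in\mathbf{X}}(\mathbf{f},\mathbf{v})/\|\nabla\mathbf{v}\|$. $\mathbf{X}_h\subset\mathbf{X}$, $Q_h\subset Q$ are finite element spaces on a regular conforming triangulation of $\Omega$ with maximal diameter $h$, satisfying the discrete inf-sup condition $\inf_{q_h\in Q_h}\sup_{\mathbf{v}_h\in\mathbf{X}_h}\frac{(q_h,\nabla\cdot\mathbf{v}_h)}{\|\nabla\mathbf{v}_h\|\,\|q_h\|}\ge\beta_0>0$. Data: $\nu>0$ is the kinematic viscosity, $\mathbf{f}$ the body force (with values at the times $t^{n}$), $T$ the final time, $N$ the number of time steps, $\Delta t=T/N$, $t^n=n\Delta t$. $\mathbf{u}_h^0$ and $\mathbf{u}_h^{-1}$ are both the nodal interpolant in $\mathbf{X}_h$ of the initial velocity $\mathbf{u}_0$. Trilinear form (EMAC): $c(\mathbf{u},\mathbf{v},\mathbf{w})=2(\mathbb{D}(\mathbf{u})\mathbf{v},\mathbf{w})+((\nabla\cdot\mathbf{u})\mathbf{v},\mathbf{w})$ with $\mathbb{D}(\mathbf{u})=\frac12(\nabla\mathbf{u}+(\nabla\mathbf{u})^T)$.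 Algorithm: for $n=0,1,\dots,N-1$, Step 1: find $(\tilde{\mathbf{u}}_h^{n+1},P_h^{n+1})\in\mathbf{X}_h\times Q_h$ such that for all $(\mathbf{v}_h,q_h)\in\mathbf{X}_h\times Q_h$ $$\Big(\frac{\tilde{\mathbf{u}}_h^{n+1}-\mathbf{u}_h^n}{\Delta t},\mathbf{v}_h\Big)+\nu(\nabla\tilde{\mathbf{u}}_h^{n+1},\nabla\mathbf{v}_h)+c(\tilde{\mathbf{u}}_h^{n+1},\tilde{\mathbf{u}}_h^{n+1},\mathbf{v}_h)-(P_h^{n+1},\nabla\cdot\mathbf{v}_h)=(\mathbf{f}(t^{n+1}),\mathbf{v}_h),\qquad(\nabla\cdot\tilde{\mathbf{u}}_h^{n+1},q_h)=0.$$ Step 2: $\mathbf{u}_h^{n+1}=\tilde{\mathbf{u}}_h^{n+1}-\frac13(\tilde{\mathbf{u}}_h^{n+1}-2\mathbf{u}_h^n+\mathbf{u}_h^{n-1})$. Notation: $F[\mathbf{w}^{n+1}]=\frac32\mathbf{w}^{n+1}-\mathbf{w}^n+\frac12\mathbf{w}^{n-1}$ (so $\tilde{\mathbf{u}}_h^{n+1}=F[\mathbf{u}_h^{n+1}]$), and $\|\mathbf{u}\|_F^2=(\mathbf{u},3\mathbf{u})=3\|\mathbf{u}\|^2$. *)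

theory Defs
  imports "HOL-Analysis.Analysis"
begin

subsection \<open>Lebesgue and Sobolev spaces\<close>

text \<open>
  Elements of the function spaces are represented by functions on the whole of \<open>\<real>\<^sup>d\<close>; only
  their values almost everywhere in \<open>\<Omega>\<close> matter. On matrix-valued functions \<open>\<bullet>\<close> is the Frobenius
  product, so the same \<open>L\<^sup>2\<close> notions serve for pressures, velocities and velocity gradients.
\<close>

definition L2 :: "(real^'d) set \<Rightarrow> (real^'d \<Rightarrow> 'b::euclidean_space) set" where
  "L2 \<Omega> = {u. u \<in> borel_measurable (lebesgue_on \<Omega>) \<and> integrable (lebesgue_on \<Omega>) (\<lambda>x. (norm (u x))\<^sup>2)}"

definition L2_inner ::
  "(real^'d) set \<Rightarrow> (real^'d \<Rightarrow> 'b::euclidean_space) \<Rightarrow> (real^'d \<Rightarrow> 'b) \<Rightarrow> real" where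
  "L2_inner \<Omega> u v = (\<integral>x. u x \<bullet> v x \<partial>(lebesgue_on \<Omega>))"

definition L2_norm :: "(real^'d) set \<Rightarrow> (real^'d \<Rightarrow> 'b::euclidean_space) \<Rightarrow> real" where
  "L2_norm \<Omega> u = sqrt (L2_inner \<Omega> u u)"

definition L20 :: "(real^'d) set \<Rightarrow> (real^'d \<Rightarrow> real) set" where
  "L20 \<Omega> = {q \<in> L2 \<Omega>. (\<integral>x. q x \<partial>(lebesgue_on \<Omega>)) = 0}"

definition L2_zero :: "(real^'d) set \<Rightarrow> (real^'d \<Rightarrow> 'b::euclidean_space) \<Rightarrow> bool" where
  "L2_zero \<Omega> u \<longleftrightarrow> (AE x in lebesgue_on \<Omega>. u x = 0)"

definition partial_deriv :: "'d \<Rightarrow> (real^'d \<Rightarrow> 'b::real_normed_vector) \<Rightarrow> real^'d \<Rightarrow> 'b" where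
  "partial_deriv j f x = frechet_derivative f (at x) (axis j 1)"

primrec Ck :: "nat \<Rightarrow> (real^'d \<Rightarrow> 'b::real_normed_vector) \<Rightarrow> bool" where
  "Ck 0 f = continuous_on UNIV f"
| "Ck (Suc k) f = ((\<forall>x. f differentiable (at x)) \<and> (\<forall>j. Ck k (partial_deriv j f)))"

definition test_functions :: "(real^'d) set \<Rightarrow> (real^'d \<Rightarrow> 'b::real_normed_vector) set" where
  "test_functions \<Omega> =
    {\<phi>. (\<forall>k. Ck k \<phi>) \<and> compact (closure {x. \<phi> x \<noteq> 0}) \<and> closure {x. \<phi> x \<noteq> 0} \<subseteq> \<Omega>}"

text \<open>The entry \<open>G x $ i $ j\<close> is the weak derivative of the component \<open>u\<^sub>i\<close> in direction \<open>x\<^sub>j\<close>.\<close>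

definition weak_gradient ::
  "(real^'d) set \<Rightarrow> (real^'d \<Rightarrow> real^'d) \<Rightarrow> (real^'d \<Rightarrow> real^'d^'d) \<Rightarrow> bool" where
  "weak_gradient \<Omega> u G \<longleftrightarrow>
    (\<forall>i j. \<forall>\<phi> \<in> test_functions \<Omega>.
       (\<integral>x. u x $ i * partial_deriv j \<phi> x \<partial>(lebesgue_on \<Omega>)) =
       - (\<integral>x. G x $ i $ j * \<phi> x \<partial>(lebesgue_on \<Omega>)))"

definition H1 :: "(real^'d) set \<Rightarrow> (real^'d \<Rightarrow> real^'d) set" where
  "H1 \<Omega> = {u \<in> L2 \<Omega>. \<exists>G \<in> L2 \<Omega>. weak_gradient \<Omega> u G}"

text \<open>The weak gradient is unique up to null sets; the choice of representative is immaterial.\<close>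

definition grad :: "(real^'d) set \<Rightarrow> (real^'d \<Rightarrow> real^'d) \<Rightarrow> real^'d \<Rightarrow> real^'d^'d" where
  "grad \<Omega> u = (SOME G. G \<in> L2 \<Omega> \<and> weak_gradient \<Omega> u G)"

definition divergence :: "(real^'d) set \<Rightarrow> (real^'d \<Rightarrow> real^'d) \<Rightarrow> real^'d \<Rightarrow> real" where
  "divergence \<Omega> u x = trace (grad \<Omega> u x)"

definition sym_grad :: "(real^'d) set \<Rightarrow> (real^'d \<Rightarrow> real^'d) \<Rightarrow> real^'d \<Rightarrow> real^'d^'d" where
  "sym_grad \<Omega> u x = (1/2) *\<^sub>R (grad \<Omega> u x + transpose (grad \<Omega> u x))"

text \<open>
  \<open>(H\<^sub>0\<^sup>1(\<Omega>))\<^sup>d\<close>, the closure of the test functions in the \<open>H\<^sup>1\<close> norm. For the smooth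
  approximants the weak gradient is the classical Jacobian matrix.
\<close>

definition H10 :: "(real^'d) set \<Rightarrow> (real^'d \<Rightarrow> real^'d) set" where
  "H10 \<Omega> = {u \<in> H1 \<Omega>. \<exists>\<phi> :: nat \<Rightarrow> real^'d \<Rightarrow> real^'d.
     (\<forall>k. \<phi> k \<in> test_functions \<Omega>) \<and>
     (\<lambda>k. L2_norm \<Omega> (\<lambda>x. \<phi> k x - u x)) \<longlonglongrightarrow> 0 \<and>
     (\<lambda>k. L2_norm \<Omega> (\<lambda>x. jacobian (\<phi> k) (at x) - grad \<Omega> u x)) \<longlonglongrightarrow> 0}"

text \<open>
  The dual of \<open>H10\<close>, normed by the \<open>L\<^sup>2\<close> norm of the gradient. A functional \<open>F\<close> is only
  constrained on \<open>H10 \<Omega>\<close>; the duality pairing \<open>(F, v)\<close> is \<open>F v\<close>.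
\<close>

definition Hm1 :: "(real^'d) set \<Rightarrow> ((real^'d \<Rightarrow> real^'d) \<Rightarrow> real) set" where
  "Hm1 \<Omega> = {F.
     (\<forall>u \<in> H10 \<Omega>. \<forall>v \<in> H10 \<Omega>. \<forall>a b. F (\<lambda>x. a *\<^sub>R u x + b *\<^sub>R v x) = a * F u + b * F v) \<and>
     (\<exists>C. \<forall>v \<in> H10 \<Omega>. \<bar>F v\<bar> \<le> C * L2_norm \<Omega> (grad \<Omega> v))}"

definition Hm1_norm :: "(real^'d) set \<Rightarrow> ((real^'d \<Rightarrow> real^'d) \<Rightarrow> real) \<Rightarrow> real" where
  "Hm1_norm \<Omega> F = (SUP v \<in> {v \<in> H10 \<Omega>. \<not> L2_zero \<Omega> v}. F v / L2_norm \<Omega> (grad \<Omega> v))"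

text \<open>\<open>L\<^sup>\<infinity>(0,T;H\<^sup>-\<^sup>1(\<Omega>))\<close>: strongly measurable and essentially bounded.\<close>

definition Linf_Hm1 ::
  "(real^'d) set \<Rightarrow> real \<Rightarrow> (real \<Rightarrow> (real^'d \<Rightarrow> real^'d) \<Rightarrow> real) set" where
  "Linf_Hm1 \<Omega> T = {f.
     (AE t in lebesgue_on {0<..<T}. f t \<in> Hm1 \<Omega>) \<and>
     (\<exists>s. (\<forall>k. simple_function (lebesgue_on {0<..<T}) (s k) \<and> (\<forall>t \<in> {0<..<T}. s k t \<in> Hm1 \<Omega>)) \<and>
          (AE t in lebesgue_on {0<..<T}. (\<lambda>k::nat. Hm1_norm \<Omega> (\<lambda>v. s k t v - f t v)) \<longlonglongrightarrow> 0)) \<and>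
     (\<exists>C. AE t in lebesgue_on {0<..<T}. Hm1_norm \<Omega> (f t) \<le> C)}"

subsection \<open>Domain, mesh and finite element spaces\<close>

definition convex_polytopal_domain :: "(real^'d) set \<Rightarrow> bool" where
  "convex_polytopal_domain \<Omega> \<longleftrightarrow>
     open \<Omega> \<and> \<Omega> \<noteq> {} \<and> bounded \<Omega> \<and> convex \<Omega> \<and> polytope (closure \<Omega>)"

definition insphere_diameter :: "(real^'d) set \<Rightarrow> real" where
  "insphere_diameter K = Sup {2 * r |r. 0 \<le> r \<and> (\<exists>x. cball x r \<subseteq> K)}"

text \<open>
  \<open>triangulation\<close> contains conformity: two elements meet in a common (possibly empty) face.
  Regularity is shape-regularity with constant \<open>\<sigma>\<close>.
\<close>

definition regular_mesh :: "(real^'d) set \<Rightarrow> real \<Rightarrow> real \<Rightarrow> (real^'d) set set \<Rightarrow> bool" where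
  "regular_mesh \<Omega> \<sigma> h \<T> \<longleftrightarrow>
     triangulation \<T> \<and> (\<forall>K \<in> \<T>. int CARD('d) simplex K) \<and> \<Union>\<T> = closure \<Omega> \<and>
     (\<forall>K \<in> \<T>. diameter K \<le> \<sigma> * insphere_diameter K) \<and>
     h = Max (diameter ` \<T>)"

text \<open>A finite element space is a finite-dimensional space of piecewise polynomials. On the
  element boundaries (a null set) a discontinuous function may take any value.\<close>

definition piecewise_polynomial ::
  "(real^'d) set set \<Rightarrow> (real^'d \<Rightarrow> 'b::euclidean_space) \<Rightarrow> bool" where
  "piecewise_polynomial \<T> v \<longleftrightarrow>
     (\<forall>K \<in> \<T>. \<exists>p. polynomial_function p \<and> (\<forall>x \<in> interior K. v x = p x))"

definition fe_space ::
  "(real^'d) set set \<Rightarrow> (real^'d \<Rightarrow> 'b::euclidean_space) set \<Rightarrow> bool" where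
  "fe_space \<T> V \<longleftrightarrow>
     (\<exists>B. finite B \<and> (\<forall>b \<in> B. piecewise_polynomial \<T> b) \<and>
          V = {v. \<exists>c. v = (\<lambda>x. \<Sum>b\<in>B. c b *\<^sub>R b x)})"

text \<open>
  Velocities are represented by the continuous function extended by zero outside \<open>\<Omega>\<close>. Since they
  vanish on the boundary, only the nodes inside \<open>\<Omega>\<close> carry degrees of freedom; \<open>A\<close> is the set of
  these nodes.
\<close>

definition velocity_space ::
  "(real^'d) set \<Rightarrow> (real^'d) set set \<Rightarrow> (real^'d) set \<Rightarrow> (real^'d \<Rightarrow> real^'d) set \<Rightarrow> bool" where
  "velocity_space \<Omega> \<T> A X \<longleftrightarrow>
     fe_space \<T> X \<and> X \<subseteq> H10 \<Omega> \<and>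
     (\<forall>v \<in> X. continuous_on UNIV v \<and> (\<forall>x. x \<notin> \<Omega> \<longrightarrow> v x = 0)) \<and>
     finite A \<and> A \<subseteq> \<Omega> \<and> (\<forall>w. \<exists>!v. v \<in> X \<and> (\<forall>a \<in> A. v a = w a))"

definition pressure_space ::
  "(real^'d) set \<Rightarrow> (real^'d) set set \<Rightarrow> (real^'d \<Rightarrow> real) set \<Rightarrow> bool" where
  "pressure_space \<Omega> \<T> Q \<longleftrightarrow> fe_space \<T> Q \<and> Q \<subseteq> L20 \<Omega>"

definition nodal_interpolant ::
  "(real^'d) set \<Rightarrow> (real^'d \<Rightarrow> real^'d) set \<Rightarrow> (real^'d \<Rightarrow> real^'d) \<Rightarrow> real^'d \<Rightarrow> real^'d" where
  "nodal_interpolant A X w = (THE v. v \<in> X \<and> (\<forall>a \<in> A. v a = w a))"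

text \<open>Infimum and supremum are taken in the extended reals.\<close>

definition discrete_inf_sup ::
  "(real^'d) set \<Rightarrow> (real^'d \<Rightarrow> real^'d) set \<Rightarrow> (real^'d \<Rightarrow> real) set \<Rightarrow> real \<Rightarrow> bool" where
  "discrete_inf_sup \<Omega> X Q \<beta> \<longleftrightarrow>
     (INF q \<in> {q \<in> Q. \<not> L2_zero \<Omega> q}. SUP v \<in> {v \<in> X. \<not> L2_zero \<Omega> v}.
        ereal (L2_inner \<Omega> q (divergence \<Omega> v) / (L2_norm \<Omega> (grad \<Omega> v) * L2_norm \<Omega> q))) \<ge> ereal \<beta>"

subsection \<open>The time-filtered backward Euler EMAC scheme\<close>

definition emac ::
  "(real^'d) set \<Rightarrow> (real^'d \<Rightarrow> real^'d) \<Rightarrow> (real^'d \<Rightarrow> real^'d) \<Rightarrow> (real^'d \<Rightarrow> real^'d) \<Rightarrow> real" where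
  "emac \<Omega> u v w =
     2 * L2_inner \<Omega> (\<lambda>x. sym_grad \<Omega> u x *v v x) w + L2_inner \<Omega> (\<lambda>x. divergence \<Omega> u x *\<^sub>R v x) w"

text \<open>
  Time levels are integers because the scheme starts from \<open>u (-1)\<close> and \<open>u 0\<close>. Here \<open>ut\<close> is
  the unfiltered velocity and \<open>P\<close> the pressure.
\<close>

definition filtered_emac_scheme ::
  "(real^'d) set \<Rightarrow> (real^'d \<Rightarrow> real^'d) set \<Rightarrow> (real^'d \<Rightarrow> real) set \<Rightarrow> real \<Rightarrow>
   (real \<Rightarrow> (real^'d \<Rightarrow> real^'d) \<Rightarrow> real) \<Rightarrow> real \<Rightarrow> nat \<Rightarrow>
   (int \<Rightarrow> real^'d \<Rightarrow> real^'d) \<Rightarrow> (int \<Rightarrow> real^'d \<Rightarrow> real^'d) \<Rightarrow> (int \<Rightarrow> real^'d \<Rightarrow> real) \<Rightarrow> bool" where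
  "filtered_emac_scheme \<Omega> X Q \<nu> f dt N u ut P \<longleftrightarrow>
     (\<forall>n \<in> {0..int N - 1}.
        ut (n + 1) \<in> X \<and> P (n + 1) \<in> Q \<and>
        (\<forall>v \<in> X.
           L2_inner \<Omega> (\<lambda>x. (1 / dt) *\<^sub>R (ut (n + 1) x - u n x)) v
           + \<nu> * L2_inner \<Omega> (grad \<Omega> (ut (n + 1))) (grad \<Omega> v)
           + emac \<Omega> (ut (n + 1)) (ut (n + 1)) v
           - L2_inner \<Omega> (P (n + 1)) (divergence \<Omega> v)
           = f (real_of_int (n + 1) * dt) v) \<and>
        (\<forall>q \<in> Q. L2_inner \<Omega> (divergence \<Omega> (ut (n + 1))) q = 0) \<and>
        u (n + 1) = (\<lambda>x. ut (n + 1) x - (1/3) *\<^sub>R (ut (n + 1) x - 2 *\<^sub>R u n x + u (n - 1) x)))"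

text \<open>\<open>filter_F w m\<close> is \<open>F[w\<^sup>m]\<close>, involving the time levels \<open>m\<close>, \<open>m - 1\<close> and \<open>m - 2\<close>.\<close>

definition filter_F :: "(int \<Rightarrow> real^'d \<Rightarrow> real^'d) \<Rightarrow> int \<Rightarrow> real^'d \<Rightarrow> real^'d" where
  "filter_F w m x = (3/2) *\<^sub>R w m x - w (m - 1) x + (1/2) *\<^sub>R w (m - 2) x"

definition F_norm :: "(real^'d) set \<Rightarrow> (real^'d \<Rightarrow> real^'d) \<Rightarrow> real" where
  "F_norm \<Omega> u = sqrt (L2_inner \<Omega> u (\<lambda>x. 3 *\<^sub>R u x))"

end

(* Testing the scheme with the unfiltered velocity F[u^(n+1)] makes the pressure term vanish, and the
   EMAC form c(v,v,v) vanishes on H10 (integration by parts). With x, y, z the values of u at the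
   levels n + 1, n, n - 1, the time derivative obeys the exact identity
     (F - y, F) = E(x,y) - E(y,z) + 3/4 |x - 2y + z|^2,  E(x,y) = 3/2 |x|^2 - 3/2 (x,y) + 1/2 |y|^2,
   so E decreases up to the force. Since 4/3 E(x,y) - |x|^2 + 1/3 |y|^2 = |x - y|^2, the energy bound
   gives |u^n|^2 <= 1/3 |u^(n-1)|^2 + B, and iterating yields (1/3)^N |u^0|^2 + 3/2 B. *)

theory Submission
  imports Defs
begin

subsection \<open>The space of square integrable functions\<close>

text \<open>4/3 E alone dominates only |x|^2/2, which would cost a factor 2. Completing the square
  in 4/3 E instead keeps |x|^2 with coefficient 1 at the price of |y|^2/3 from the previous level;
  since 1/3 < 1 this debt is summable, with total factor 1/(1 - 1/3) = 3/2. The bound obtained is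
  thus independent of N apart from the sums and the decaying term. The factors N of the claim enter
  only at the end, where N = 1 is separate because 3/2 exceeds 1. The balance is used from n = 1 on,
  so u^1 stays on the right as data. The analytic obstacle is the cubic term: weak gradients accept
  only smooth test functions, and products of v with its gradient must be integrable. Finite element
  velocities are continuous, hence bounded on the bounded domain, and this boundedness takes the
  place of a Sobolev embedding.\<close>

lemma L2_inner_integrable:
  fixes u v :: "real^'d \<Rightarrow> 'b::euclidean_space"
  assumes "u \<in> L2 \<Omega>" "v \<in> L2 \<Omega>"
  shows "integrable (lebesgue_on \<Omega>) (\<lambda>x. u x \<bullet> v x)"
proof (rule Bochner_Integration.integrable_bound)
  show "integrable (lebesgue_on \<Omega>) (\<lambda>x. (norm (u x))\<^sup>2 + (norm (v x))\<^sup>2)"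
    using assms by (auto simp: L2_def)
  show "(\<lambda>x. u x \<bullet> v x) \<in> borel_measurable (lebesgue_on \<Omega>)"
    using assms by (auto simp: L2_def)
  have "\<bar>a \<bullet> b\<bar> \<le> (norm a)\<^sup>2 + (norm b)\<^sup>2" for a b :: 'b
  proof -
    have "norm a * norm b \<le> (norm a)\<^sup>2 + (norm b)\<^sup>2"
      using sum_squares_bound[of "norm a" "norm b"] mult_nonneg_nonneg[OF norm_ge_zero norm_ge_zero, of a b]
      unfolding mult.assoc by linarith
    then show ?thesis using Cauchy_Schwarz_ineq2[of a b] by linarith
  qed
  then show "AE x in lebesgue_on \<Omega>. norm (u x \<bullet> v x) \<le> norm ((norm (u x))\<^sup>2 + (norm (v x))\<^sup>2)"
    by simp
qed

lemma L2I:
  assumes "u \<in> borel_measurable (lebesgue_on \<Omega>)"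
    and "g \<in> L2 \<Omega>" "\<And>x. x \<in> \<Omega> \<Longrightarrow> norm (u x) \<le> C * norm (g x)"
  shows "u \<in> L2 \<Omega>"
proof -
  have "integrable (lebesgue_on \<Omega>) (\<lambda>x. (norm (u x))\<^sup>2)"
  proof (rule Bochner_Integration.integrable_bound)
    show "integrable (lebesgue_on \<Omega>) (\<lambda>x. C\<^sup>2 * (norm (g x))\<^sup>2)"
      using assms by (auto simp: L2_def)
    have "(norm (u x))\<^sup>2 \<le> C\<^sup>2 * (norm (g x))\<^sup>2" if "x \<in> \<Omega>" for x
      using power_mono[OF assms(3)[OF that] norm_ge_zero, of 2] by (simp add: power_mult_distrib)
    then show "AE x in lebesgue_on \<Omega>. norm ((norm (u x))\<^sup>2) \<le> norm (C\<^sup>2 * (norm (g x))\<^sup>2)"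
      by (auto intro!: AE_I2 simp: space_restrict_space)
  qed (use assms in auto)
  then show ?thesis using assms by (auto simp: L2_def)
qed

lemma L2_lincomb:
  assumes "u \<in> L2 \<Omega>" "v \<in> L2 \<Omega>"
  shows "(\<lambda>x. a *\<^sub>R u x + b *\<^sub>R v x) \<in> L2 \<Omega>"
proof -
  have "integrable (lebesgue_on \<Omega>) (\<lambda>x. a\<^sup>2 * (u x \<bullet> u x) + 2 * a * b * (u x \<bullet> v x) + b\<^sup>2 * (v x \<bullet> v x))"
    using assms by (intro Bochner_Integration.integrable_add integrable_mult_right L2_inner_integrable)
  moreover have "(\<lambda>x. a\<^sup>2 * (u x \<bullet> u x) + 2 * a * b * (u x \<bullet> v x) + b\<^sup>2 * (v x \<bullet> v x)) =
      (\<lambda>x. (norm (a *\<^sub>R u x + b *\<^sub>R v x))\<^sup>2)"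
    unfolding power2_norm_eq_inner
    by (simp add: inner_add_left inner_add_right inner_commute power2_eq_square algebra_simps)
  ultimately show ?thesis using assms by (auto simp: L2_def)
qed

lemma L2_diff: "u \<in> L2 \<Omega> \<Longrightarrow> v \<in> L2 \<Omega> \<Longrightarrow> (\<lambda>x. u x - v x) \<in> L2 \<Omega>"
  using L2_lincomb[of u \<Omega> v 1 "-1"] by simp

section \<open>Bilinearity, Cauchy-Schwarz and limits of inner products\<close>

lemma L2_inner_lincomb:
  assumes "u \<in> L2 \<Omega>" "v \<in> L2 \<Omega>" "w \<in> L2 \<Omega>"
  shows "L2_inner \<Omega> (\<lambda>x. a *\<^sub>R u x + b *\<^sub>R v x) w = a * L2_inner \<Omega> u w + b * L2_inner \<Omega> v w"
  using L2_inner_integrable[OF assms(1,3)] L2_inner_integrable[OF assms(2,3)]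
  by (simp add: L2_inner_def inner_add_left)

lemma L2_inner_commute: "L2_inner \<Omega> u v = L2_inner \<Omega> v u"
  by (simp add: L2_inner_def inner_commute)

lemma L2_inner_self_nonneg: "0 \<le> L2_inner \<Omega> u u"
  by (simp add: L2_inner_def)

lemma L2_norm_squared: "(L2_norm \<Omega> u)\<^sup>2 = L2_inner \<Omega> u u"
  by (simp add: L2_norm_def L2_inner_self_nonneg)

lemma L2_norm_nonneg: "0 \<le> L2_norm \<Omega> u"
  by (simp add: L2_norm_def L2_inner_self_nonneg)

text \<open>This is the squared norm of \<open>s u + t v\<close>, expanded. Cauchy-Schwarz and every
  later estimate between the energy and the norms is an instance with suitable \<open>s\<close> and
  \<open>t\<close>.\<close>

lemma L2_inner_quadratic_nonneg:
  assumes "u \<in> L2 \<Omega>" "v \<in> L2 \<Omega>"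
  shows "0 \<le> s\<^sup>2 * L2_inner \<Omega> u u + 2 * s * t * L2_inner \<Omega> u v + t\<^sup>2 * L2_inner \<Omega> v v"
proof -
  define w where "w = (\<lambda>x. s *\<^sub>R u x + t *\<^sub>R v x)"
  have w: "w \<in> L2 \<Omega>" unfolding w_def by (rule L2_lincomb[OF assms])
  have lin: "L2_inner \<Omega> w y = s * L2_inner \<Omega> u y + t * L2_inner \<Omega> v y" if "y \<in> L2 \<Omega>" for y
    unfolding w_def by (rule L2_inner_lincomb[OF assms that])
  have "L2_inner \<Omega> w w = s * L2_inner \<Omega> w u + t * L2_inner \<Omega> w v"
    using lin[OF w] L2_inner_commute[of \<Omega> u w] L2_inner_commute[of \<Omega> v w] by simp
  then show ?thesis
    using lin[OF assms(1)] lin[OF assms(2)] L2_inner_commute[of \<Omega> v u] L2_inner_self_nonneg[of \<Omega> w]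
    by (simp add: power2_eq_square algebra_simps)
qed

lemma L2_Cauchy_Schwarz:
  assumes "u \<in> L2 \<Omega>" "v \<in> L2 \<Omega>"
  shows "\<bar>L2_inner \<Omega> u v\<bar> \<le> L2_norm \<Omega> u * L2_norm \<Omega> v"
proof -
  let ?a = "L2_inner \<Omega> u u" and ?b = "L2_inner \<Omega> u v" and ?c = "L2_inner \<Omega> v v"
  note q = L2_inner_quadratic_nonneg[OF assms]
  have "?b\<^sup>2 \<le> ?a * ?c"
  proof (cases "?c = 0")
    case True
    have "?b = 0"
    proof (rule ccontr)
      assume "?b \<noteq> 0"
      \<comment> \<open>With \<open>?c = 0\<close> the quadratic is affine in \<open>t\<close>; this
        \<open>t\<close> gives it the value -1.\<close>
      then show False using q[of 1 "- (?a + 1) / (2 * ?b)"] True by (simp add: field_simps)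
    qed
    then show ?thesis using True by simp
  next
    case False
    then have "0 < ?c" using L2_inner_self_nonneg[of \<Omega> v] by simp
    have "0 \<le> ?c * (?a * ?c - ?b\<^sup>2)"
      \<comment> \<open>The choice s = \<open>?c\<close>, t = - \<open>?b\<close> minimises over the
        ratio t/s without dividing; the value factors as \<open>?c\<close> times the Cauchy-Schwarz
        gap.\<close>
      using q[of ?c "- ?b"] by (simp add: power2_eq_square algebra_simps)
    then show ?thesis using \<open>0 < ?c\<close> by (simp add: zero_le_mult_iff)
  qed
  then have "\<bar>?b\<bar> \<le> sqrt (?a * ?c)" by (simp add: real_le_rsqrt)
  then show ?thesis by (simp add: L2_norm_def real_sqrt_mult)
qed

text \<open>Cauchy-Schwarz against a fixed \<open>w\<close>. Products of approximants are therefore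
  passed to the limit one factor at a time, with everything else collected in
  \<open>w\<close>.\<close>

lemma L2_inner_tendsto:
  assumes "\<And>k. \<phi> k \<in> L2 \<Omega>" "u \<in> L2 \<Omega>" "w \<in> L2 \<Omega>"
    and "(\<lambda>k. L2_norm \<Omega> (\<lambda>x. \<phi> k x - u x)) \<longlonglongrightarrow> 0"
  shows "(\<lambda>k. L2_inner \<Omega> (\<phi> k) w) \<longlonglongrightarrow> L2_inner \<Omega> u w"
proof (rule LIM_zero_cancel)
  have "L2_inner \<Omega> (\<phi> k) w - L2_inner \<Omega> u w = L2_inner \<Omega> (\<lambda>x. \<phi> k x - u x) w" for k
    using L2_inner_lincomb[OF assms(1)[of k] assms(2,3), of 1 "-1"] by simp
  then have bound: "norm (L2_inner \<Omega> (\<phi> k) w - L2_inner \<Omega> u w)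
      \<le> L2_norm \<Omega> (\<lambda>x. \<phi> k x - u x) * L2_norm \<Omega> w" for k
    using L2_Cauchy_Schwarz[OF L2_diff[OF assms(1,2)] assms(3), of k] by simp
  have lim: "(\<lambda>k. L2_norm \<Omega> (\<lambda>x. \<phi> k x - u x) * L2_norm \<Omega> w) \<longlonglongrightarrow> 0"
    using tendsto_mult_left_zero[OF assms(4)] by simp
  show "(\<lambda>k. L2_inner \<Omega> (\<phi> k) w - L2_inner \<Omega> u w) \<longlonglongrightarrow> 0"
    using bound by (intro Lim_null_comparison[OF _ lim] always_eventually) simp
qed

text \<open>The entries may themselves be vectors, so two applications reach the scalar entries of a
  gradient.\<close>

lemma L2_component:
  fixes u :: "real^'d \<Rightarrow> 'b::euclidean_space^'n"
  assumes "u \<in> L2 \<Omega>"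
  shows "(\<lambda>x. u x $ i) \<in> L2 \<Omega>"
proof (rule L2I[where g = u and C = 1])
  have "(\<lambda>y::'b^'n. y $ i) \<in> borel_measurable borel"
    by (intro borel_measurable_continuous_onI continuous_intros)
  with assms show "(\<lambda>x. u x $ i) \<in> borel_measurable (lebesgue_on \<Omega>)"
    by (auto simp: L2_def intro: measurable_compose)
qed (use assms Finite_Cartesian_Product.norm_nth_le in auto)

lemma L2_norm_component_le:
  fixes u :: "real^'d \<Rightarrow> 'b::euclidean_space^'n"
  assumes "u \<in> L2 \<Omega>"
  shows "L2_norm \<Omega> (\<lambda>x. u x $ i) \<le> L2_norm \<Omega> u"
proof -
  have "(u x $ i) \<bullet> (u x $ i) \<le> u x \<bullet> u x" for x
    using Finite_Cartesian_Product.norm_nth_le[of "u x" i] by (simp add: norm_le)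
  then show ?thesis
    unfolding L2_norm_def L2_inner_def using assms
    by (intro real_sqrt_le_mono integral_mono L2_inner_integrable L2_component)
qed

lemma L2_tendsto_component:
  fixes u :: "real^'d \<Rightarrow> 'b::euclidean_space^'n"
  assumes "\<And>k. \<phi> k \<in> L2 \<Omega>" "u \<in> L2 \<Omega>" "(\<lambda>k. L2_norm \<Omega> (\<lambda>x. \<phi> k x - u x)) \<longlonglongrightarrow> 0"
  shows "(\<lambda>k. L2_norm \<Omega> (\<lambda>x. \<phi> k x $ i - u x $ i)) \<longlonglongrightarrow> 0"
proof (rule tendsto_sandwich[OF _ _ tendsto_const assms(3)])
  show "\<forall>\<^sub>F k in sequentially. L2_norm \<Omega> (\<lambda>x. \<phi> k x $ i - u x $ i) \<le> L2_norm \<Omega> (\<lambda>x. \<phi> k x - u x)"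
    using L2_norm_component_le[OF L2_diff[OF assms(1,2)], of _ i] by simp
qed (simp add: L2_norm_nonneg)

section \<open>Continuous functions on a bounded open set\<close>

lemma continuous_measurable:
  fixes f :: "real^'d \<Rightarrow> 'b::euclidean_space"
  assumes "\<Omega> \<in> sets lebesgue" "continuous_on UNIV f"
  shows "f \<in> borel_measurable (lebesgue_on \<Omega>)"
  using assms by (intro continuous_imp_measurable_on_sets_lebesgue) (auto intro: continuous_on_subset)

text \<open>The bound comes from the compact closure of \<open>\<Omega>\<close>; continuity on
  \<open>\<Omega>\<close> alone would permit blow-up at the boundary.\<close>

lemma continuous_bound:
  fixes f :: "real^'d \<Rightarrow> 'b::euclidean_space"
  assumes "bounded \<Omega>" "continuous_on UNIV f"
  obtains C where "\<And>x. x \<in> \<Omega> \<Longrightarrow> norm (f x) \<le> C"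
proof -
  have "compact (f ` closure \<Omega>)"
    using assms by (intro compact_continuous_image) (auto intro: continuous_on_subset)
  then obtain C where "\<forall>y \<in> f ` closure \<Omega>. norm y \<le> C"
    using compact_imp_bounded bounded_iff by metis
  then show ?thesis using that closure_subset by blast
qed

lemma continuous_in_L2:
  fixes f :: "real^'d \<Rightarrow> 'b::euclidean_space"
  assumes "bounded \<Omega>" "open \<Omega>" "continuous_on UNIV f"
  shows "f \<in> L2 \<Omega>"
proof -
  obtain C where C: "\<And>x. x \<in> \<Omega> \<Longrightarrow> norm (f x) \<le> C" using continuous_bound assms by metis
  have lm: "\<Omega> \<in> lmeasurable" using assms by (simp add: lmeasurable_open)
  show ?thesis
  proof (rule L2I[where g = "\<lambda>x. 1::real" and C = C])
    show "(\<lambda>x. 1::real) \<in> L2 \<Omega>"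
      using finite_measure.integrable_const[OF finite_measure_lebesgue_on[OF lm]] by (simp add: L2_def)
    show "f \<in> borel_measurable (lebesgue_on \<Omega>)"
      by (intro continuous_measurable assms fmeasurableD[OF lm])
  qed (use C in simp)
qed

text \<open>Lets a bounded velocity component multiply a gradient entry without leaving
  \<open>L2\<close>, so that all cubic integrals of the EMAC form exist.\<close>

lemma L2_mult_continuous:
  fixes f g :: "real^'d \<Rightarrow> real"
  assumes "bounded \<Omega>" "open \<Omega>" "continuous_on UNIV f" "g \<in> L2 \<Omega>"
  shows "(\<lambda>x. f x * g x) \<in> L2 \<Omega>"
proof -
  obtain C where C: "\<And>x. x \<in> \<Omega> \<Longrightarrow> norm (f x) \<le> C" using continuous_bound assms by metis
  have "f \<in> borel_measurable (lebesgue_on \<Omega>)"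
    using assms by (intro continuous_measurable) auto
  then have "(\<lambda>x. f x * g x) \<in> borel_measurable (lebesgue_on \<Omega>)"
    using assms(4) by (intro borel_measurable_times) (simp_all add: L2_def)
  moreover have "norm (f x * g x) \<le> C * norm (g x)" if "x \<in> \<Omega>" for x
    using C[OF that] mult_right_mono[of "norm (f x)" C "norm (g x)"] by (simp add: abs_mult)
  ultimately show ?thesis by (rule L2I[OF _ assms(4)])
qed

subsection \<open>Test functions\<close>

lemma Ck_continuous: "Ck k f \<Longrightarrow> continuous_on UNIV f"
  by (cases k) (auto intro: differentiable_imp_continuous_on simp: differentiable_on_def
      differentiable_at_withinI)

lemma partial_deriv_add:
  assumes "f differentiable (at x)" "g differentiable (at x)"
  shows "partial_deriv j (\<lambda>x. f x + g x) x = partial_deriv j f x + partial_deriv j g x"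
proof -
  have "((\<lambda>x. f x + g x) has_derivative
      (\<lambda>h. frechet_derivative f (at x) h + frechet_derivative g (at x) h)) (at x)"
    using assms by (intro has_derivative_add) (simp_all flip: frechet_derivative_works)
  from frechet_derivative_at[OF this, symmetric] show ?thesis
    by (simp add: partial_deriv_def)
qed

lemma Ck_add:
  assumes "Ck k f" "Ck k g"
  shows "Ck k (\<lambda>x. f x + g x)"
  using assms
proof (induction k arbitrary: f g)
  case 0
  then show ?case by (simp add: continuous_on_add)
next
  case (Suc k)
  have "partial_deriv j (\<lambda>x. f x + g x) = (\<lambda>x. partial_deriv j f x + partial_deriv j g x)" for j
    using Suc.prems by (auto simp: partial_deriv_add)
  then show ?case using Suc by simp
qed

lemma partial_deriv_mult:
  fixes f g :: "real^'d \<Rightarrow> real"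
  assumes "f differentiable (at x)" "g differentiable (at x)"
  shows "partial_deriv j (\<lambda>x. f x * g x) x = partial_deriv j f x * g x + f x * partial_deriv j g x"
proof -
  have "((\<lambda>x. f x * g x) has_derivative
      (\<lambda>h. f x * frechet_derivative g (at x) h + frechet_derivative f (at x) h * g x)) (at x)"
    using assms by (intro has_derivative_mult) (simp_all flip: frechet_derivative_works)
  from frechet_derivative_at[OF this, symmetric] show ?thesis
    by (simp add: partial_deriv_def add.commute)
qed

text \<open>The product rule mixes derivatives with undifferentiated factors, so in the induction
  for products the latter must be lowered to the order of the former.\<close>

lemma Ck_Suc_imp_Ck: "Ck (Suc k) f \<Longrightarrow> Ck k f"
proof (induction k arbitrary: f)
  case 0
  then show ?case using Ck_continuous[of "Suc 0" f] by simp
next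
  case (Suc k)
  then have "\<forall>j. Ck k (partial_deriv j f)" by simp
  then show ?case using Suc.prems by simp
qed

lemma Ck_mult:
  fixes f g :: "real^'d \<Rightarrow> real"
  assumes "Ck k f" "Ck k g"
  shows "Ck k (\<lambda>x. f x * g x)"
  using assms
proof (induction k arbitrary: f g)
  case 0
  then show ?case by (simp add: continuous_on_mult)
next
  case (Suc k)
  have "partial_deriv j (\<lambda>x. f x * g x) =
      (\<lambda>x. partial_deriv j f x * g x + f x * partial_deriv j g x)" for j
    using Suc.prems by (auto simp: partial_deriv_mult)
  moreover have "Ck k f" "Ck k g" using Suc.prems Ck_Suc_imp_Ck by auto
  ultimately show ?case using Suc by (auto intro!: Ck_add)
qed

lemma partial_deriv_component:
  fixes f :: "real^'d \<Rightarrow> real^'n"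
  assumes "f differentiable (at x)"
  shows "partial_deriv j (\<lambda>x. f x $ i) x = partial_deriv j f x $ i"
proof -
  have "((\<lambda>x. f x $ i) has_derivative (\<lambda>h. frechet_derivative f (at x) h $ i)) (at x)"
    using assms by (intro bounded_linear.has_derivative[OF bounded_linear_vec_nth])
      (simp flip: frechet_derivative_works)
  from frechet_derivative_at[OF this, symmetric] show ?thesis
    by (simp add: partial_deriv_def)
qed

lemma differentiable_component:
  fixes f :: "real^'d \<Rightarrow> real^'n"
  assumes "f differentiable F"
  shows "(\<lambda>x. f x $ i) differentiable F"
  using assms bounded_linear.has_derivative[OF bounded_linear_vec_nth, of f _ F i]
  unfolding differentiable_def by blast

lemma Ck_component:
  fixes f :: "real^'d \<Rightarrow> real^'n"
  assumes "Ck k f"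
  shows "Ck k (\<lambda>x. f x $ i)"
  using assms
proof (induction k arbitrary: f)
  case 0
  then show ?case by (auto intro: continuous_intros)
next
  case (Suc k)
  have "partial_deriv j (\<lambda>x. f x $ i) = (\<lambda>x. partial_deriv j f x $ i)" for j
    using Suc.prems by (auto simp: partial_deriv_component)
  then show ?case using Suc by (auto intro: differentiable_component)
qed

text \<open>A closed subset of a compact support is compact, so for components and products of test
  functions only smoothness is left to check.\<close>

lemma test_functionI:
  assumes "\<phi> \<in> test_functions \<Omega>" "\<And>k. Ck k \<psi>" "{x. \<psi> x \<noteq> 0} \<subseteq> {x. \<phi> x \<noteq> 0}"
  shows "\<psi> \<in> test_functions \<Omega>"
proof -
  have sub: "closure {x. \<psi> x \<noteq> 0} \<subseteq> closure {x. \<phi> x \<noteq> 0}" by (rule closure_mono[OF assms(3)])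
  have "compact (closure {x. \<phi> x \<noteq> 0})" "closure {x. \<phi> x \<noteq> 0} \<subseteq> \<Omega>"
    using assms(1) by (auto simp: test_functions_def)
  moreover from this(1) have "compact (closure {x. \<phi> x \<noteq> 0} \<inter> closure {x. \<psi> x \<noteq> 0})"
    by (intro compact_Int_closed closed_closure)
  ultimately show ?thesis
    using assms(2) sub by (simp add: test_functions_def Int_absorb1)
qed

lemma test_function_component:
  fixes \<phi> :: "real^'d \<Rightarrow> real^'n"
  assumes "\<phi> \<in> test_functions \<Omega>"
  shows "(\<lambda>x. \<phi> x $ i) \<in> test_functions \<Omega>"
  using assms by (intro test_functionI[OF assms] Ck_component) (auto simp: test_functions_def)

lemma test_function_mult:
  fixes \<phi> \<psi> :: "real^'d \<Rightarrow> real"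
  assumes "\<phi> \<in> test_functions \<Omega>" "\<psi> \<in> test_functions \<Omega>"
  shows "(\<lambda>x. \<phi> x * \<psi> x) \<in> test_functions \<Omega>"
  using assms by (intro test_functionI[OF assms(1)] Ck_mult) (auto simp: test_functions_def)

lemma test_function_Ck: "\<phi> \<in> test_functions \<Omega> \<Longrightarrow> Ck k \<phi>"
  by (simp add: test_functions_def)

lemma test_function_differentiable: "\<phi> \<in> test_functions \<Omega> \<Longrightarrow> \<phi> differentiable (at x)"
  using test_function_Ck[of \<phi> \<Omega> "Suc 0"] by simp

lemma test_function_continuous: "\<phi> \<in> test_functions \<Omega> \<Longrightarrow> continuous_on UNIV \<phi>"
  using test_function_Ck[of \<phi> \<Omega> 0] by simp

lemma test_function_continuous_partial_deriv:
  "\<phi> \<in> test_functions \<Omega> \<Longrightarrow> continuous_on UNIV (partial_deriv j \<phi>)"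
  using test_function_Ck[of \<phi> \<Omega> "Suc 0"] by simp

lemma jacobian_component:
  fixes \<phi> :: "real^'d \<Rightarrow> real^'n"
  assumes "\<phi> differentiable (at x)"
  shows "jacobian \<phi> (at x) $ i $ j = partial_deriv j (\<lambda>x. \<phi> x $ i) x"
  using assms by (simp add: jacobian_def matrix_def partial_deriv_component) (simp add: partial_deriv_def)

lemma test_function_continuous_jacobian:
  fixes \<phi> :: "real^'d \<Rightarrow> real^'n"
  assumes "\<phi> \<in> test_functions \<Omega>"
  shows "continuous_on UNIV (\<lambda>x. jacobian \<phi> (at x))"
proof -
  have "continuous_on UNIV (\<lambda>x. jacobian \<phi> (at x) $ i $ j)" for i j
    using test_function_continuous_partial_deriv[OF test_function_component[OF assms]]
    by (simp add: jacobian_component[OF test_function_differentiable[OF assms]])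
  then have "continuous_on UNIV (\<lambda>x. \<chi> i. \<chi> j. jacobian \<phi> (at x) $ i $ j)"
    by (intro continuous_on_vec_lambda)
  then show ?thesis by simp
qed

subsection \<open>The EMAC form\<close>

lemma grad_properties:
  assumes "v \<in> H1 \<Omega>"
  shows "grad \<Omega> v \<in> L2 \<Omega>" "weak_gradient \<Omega> v (grad \<Omega> v)"
  using assms someI_ex[of "\<lambda>G. G \<in> L2 \<Omega> \<and> weak_gradient \<Omega> v G"]
  by (auto simp: H1_def grad_def)

text \<open>The weak gradient may only be tested with smooth functions. As \<open>v\<close> is bounded but its
  approximants need not be uniformly so, the two factors of the test function are sent to \<open>v\<close> one
  after the other.\<close>

lemma H10_convection:
  fixes v :: "real^'d \<Rightarrow> real^'d"
  assumes "bounded \<Omega>" "open \<Omega>" "v \<in> H10 \<Omega>" "continuous_on UNIV v"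
  shows "2 * L2_inner \<Omega> (\<lambda>x. v x $ i) (\<lambda>x. v x $ j * grad \<Omega> v x $ i $ j) =
    - L2_inner \<Omega> (\<lambda>x. v x $ i) (\<lambda>x. v x $ i * grad \<Omega> v x $ j $ j)"
proof -
  define G where "G = grad \<Omega> v"
  have v: "v \<in> L2 \<Omega>" and G: "G \<in> L2 \<Omega>" and weak: "weak_gradient \<Omega> v G"
    using assms(3) grad_properties[of v \<Omega>] by (simp_all add: H10_def H1_def G_def)
  obtain \<phi> where \<phi>: "\<And>k::nat. \<phi> k \<in> test_functions \<Omega>"
    and lim0: "(\<lambda>k. L2_norm \<Omega> (\<lambda>x. \<phi> k x - v x)) \<longlonglongrightarrow> 0"
    and lim1: "(\<lambda>k. L2_norm \<Omega> (\<lambda>x. jacobian (\<phi> k) (at x) - G x)) \<longlonglongrightarrow> 0"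
    using assms by (auto simp: H10_def G_def)
  define a where "a k x = \<phi> k x $ i" for k x
  define da where "da k = partial_deriv j (a k)" for k
  have test: "a k \<in> test_functions \<Omega>" for k
    using test_function_component[OF \<phi>] by (simp add: a_def[abs_def])
  have cont_v: "continuous_on UNIV (\<lambda>x. v x $ l)" for l
    using assms by (intro continuous_intros)
  have cont: "continuous_on UNIV (a k)" "continuous_on UNIV (da k)" for k
    using test_function_continuous[OF test] test_function_continuous_partial_deriv[OF test]
    by (simp_all add: da_def)
  have in_L2: "a k \<in> L2 \<Omega>" "da k \<in> L2 \<Omega>" for k
    using assms cont by (auto intro: continuous_in_L2)
  have \<phi>_L2: "\<phi> k \<in> L2 \<Omega>" "(\<lambda>x. jacobian (\<phi> k) (at x)) \<in> L2 \<Omega>" for k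
    using assms(1,2) test_function_continuous[OF \<phi>] test_function_continuous_jacobian[OF \<phi>]
    by (auto intro: continuous_in_L2)
  have jac: "jacobian (\<phi> k) (at x) $ i $ j = da k x" for k x
    using jacobian_component[OF test_function_differentiable[OF \<phi>]]
    by (simp add: da_def a_def[abs_def])
  have vL2: "(\<lambda>x. v x $ l) \<in> L2 \<Omega>" for l by (rule L2_component[OF v])
  have GL2: "(\<lambda>x. G x $ l $ m) \<in> L2 \<Omega>" for l m by (rule L2_component[OF L2_component[OF G]])
  note mult_L2 = L2_mult_continuous[OF assms(1,2)]
  have lim_a: "(\<lambda>k. L2_inner \<Omega> (a k) w) \<longlonglongrightarrow> L2_inner \<Omega> (\<lambda>x. v x $ i) w" if "w \<in> L2 \<Omega>" for w
    using L2_tendsto_component[OF \<phi>_L2(1) v lim0, of i]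
    by (intro L2_inner_tendsto in_L2 vL2 that) (simp add: a_def)
  have lim_da: "(\<lambda>k. L2_inner \<Omega> (da k) w) \<longlonglongrightarrow> L2_inner \<Omega> (\<lambda>x. G x $ i $ j) w"
    if "w \<in> L2 \<Omega>" for w
    using L2_tendsto_component[OF L2_component L2_component
        L2_tendsto_component[OF \<phi>_L2(2) G lim1, of i], OF \<phi>_L2(2) G, of j]
    by (intro L2_inner_tendsto in_L2 GL2 that) (simp add: jac)
  \<comment> \<open>The weak derivative of the component \<open>v x $ j\<close> in direction
    \<open>j\<close>, tested with the product \<open>a k * a m\<close>. The indices are independent
    so that the two limits can be taken separately.\<close>
  have smooth: "L2_inner \<Omega> (da k) (\<lambda>x. v x $ j * a m x) + L2_inner \<Omega> (a k) (\<lambda>x. v x $ j * da m x) =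
      - L2_inner \<Omega> (a k) (\<lambda>x. a m x * G x $ j $ j)" for k m
  proof -
    have pd: "partial_deriv j (\<lambda>x. a k x * a m x) x = da k x * a m x + a k x * da m x" for x
      unfolding da_def by (intro partial_deriv_mult test_function_differentiable[OF test])
    have "(\<integral>x. v x $ j * partial_deriv j (\<lambda>x. a k x * a m x) x \<partial>(lebesgue_on \<Omega>)) =
        - (\<integral>x. G x $ j $ j * (a k x * a m x) \<partial>(lebesgue_on \<Omega>))"
      using weak test_function_mult[OF test test] unfolding weak_gradient_def by blast
    moreover have "integrable (lebesgue_on \<Omega>) (\<lambda>x. da k x \<bullet> (v x $ j * a m x))"
      "integrable (lebesgue_on \<Omega>) (\<lambda>x. a k x \<bullet> (v x $ j * da m x))"
      by (intro L2_inner_integrable in_L2 mult_L2 cont_v)+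
    ultimately show ?thesis
      unfolding L2_inner_def by (simp add: pd algebra_simps flip: Bochner_Integration.integral_add)
  qed
  \<comment> \<open>First limit, in \<open>k\<close>: with \<open>m\<close> fixed,
    \<open>a m\<close> and \<open>da m\<close> are continuous multipliers, so each term pairs one
    convergent factor with a fixed \<open>L2\<close> function.\<close>
  have half: "L2_inner \<Omega> (a m) (\<lambda>x. v x $ j * G x $ i $ j) + L2_inner \<Omega> (da m) (\<lambda>x. v x $ j * v x $ i) =
      - L2_inner \<Omega> (a m) (\<lambda>x. v x $ i * G x $ j $ j)" for m
  proof -
    have "(\<lambda>k. L2_inner \<Omega> (da k) (\<lambda>x. v x $ j * a m x) + L2_inner \<Omega> (a k) (\<lambda>x. v x $ j * da m x))
        \<longlonglongrightarrow> L2_inner \<Omega> (\<lambda>x. G x $ i $ j) (\<lambda>x. v x $ j * a m x)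
          + L2_inner \<Omega> (\<lambda>x. v x $ i) (\<lambda>x. v x $ j * da m x)"
      by (intro tendsto_add lim_a lim_da mult_L2 cont_v in_L2)
    moreover have "(\<lambda>k. - L2_inner \<Omega> (a k) (\<lambda>x. a m x * G x $ j $ j)) \<longlonglongrightarrow>
        - L2_inner \<Omega> (\<lambda>x. v x $ i) (\<lambda>x. a m x * G x $ j $ j)"
      by (intro tendsto_minus lim_a mult_L2 cont GL2)
    ultimately have "L2_inner \<Omega> (\<lambda>x. G x $ i $ j) (\<lambda>x. v x $ j * a m x)
          + L2_inner \<Omega> (\<lambda>x. v x $ i) (\<lambda>x. v x $ j * da m x) =
        - L2_inner \<Omega> (\<lambda>x. v x $ i) (\<lambda>x. a m x * G x $ j $ j)"
      unfolding smooth by (rule LIMSEQ_unique)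
    then show ?thesis by (simp add: L2_inner_def mult_ac)
  qed
  \<comment> \<open>Second limit, in \<open>m\<close>: now the continuity of \<open>v\<close> itself
    keeps the fixed factors in \<open>L2\<close>. The two limits on the left coincide up to the
    order of the factors, whence the 2 in the claim.\<close>
  have "(\<lambda>m. L2_inner \<Omega> (a m) (\<lambda>x. v x $ j * G x $ i $ j)
        + L2_inner \<Omega> (da m) (\<lambda>x. v x $ j * v x $ i)) \<longlonglongrightarrow>
      L2_inner \<Omega> (\<lambda>x. v x $ i) (\<lambda>x. v x $ j * G x $ i $ j)
        + L2_inner \<Omega> (\<lambda>x. G x $ i $ j) (\<lambda>x. v x $ j * v x $ i)"
    by (intro tendsto_add lim_a lim_da mult_L2 cont_v vL2 GL2)
  moreover have "(\<lambda>m. - L2_inner \<Omega> (a m) (\<lambda>x. v x $ i * G x $ j $ j)) \<longlonglongrightarrow>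
      - L2_inner \<Omega> (\<lambda>x. v x $ i) (\<lambda>x. v x $ i * G x $ j $ j)"
    by (intro tendsto_minus lim_a mult_L2 cont_v GL2)
  ultimately have "L2_inner \<Omega> (\<lambda>x. v x $ i) (\<lambda>x. v x $ j * G x $ i $ j)
        + L2_inner \<Omega> (\<lambda>x. G x $ i $ j) (\<lambda>x. v x $ j * v x $ i) =
      - L2_inner \<Omega> (\<lambda>x. v x $ i) (\<lambda>x. v x $ i * G x $ j $ j)"
    unfolding half by (rule LIMSEQ_unique)
  then show ?thesis by (simp add: L2_inner_def mult_ac G_def)
qed

text \<open>Formally 2 D(v)v . v = v . grad |v|^2, which integrates to - (div v) |v|^2 and is offset
  by the second term of the form. The cancellation holds for each index pair. Its exactness matters
  because discrete velocities satisfy the divergence constraint only against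
  \<open>Q\<close>.\<close>

lemma emac_self_eq_0:
  fixes v :: "real^'d \<Rightarrow> real^'d"
  assumes "bounded \<Omega>" "open \<Omega>" "v \<in> H10 \<Omega>" "continuous_on UNIV v"
  shows "emac \<Omega> v v v = 0"
proof -
  let ?G = "grad \<Omega> v"
  have v: "v \<in> L2 \<Omega>" and G: "?G \<in> L2 \<Omega>"
    using assms grad_properties by (auto simp: H10_def H1_def)
  have int: "integrable (lebesgue_on \<Omega>) (\<lambda>x. v x $ i * (v x $ j * ?G x $ k $ l))" for i j k l
    using L2_inner_integrable[OF L2_component[OF v, of i]
        L2_mult_continuous[OF assms(1,2) _ L2_component[OF L2_component[OF G]]], of "\<lambda>x. v x $ j" k l]
      assms(4) by (simp add: continuous_intros)
  have sym: "(sym_grad \<Omega> v x *v v x) \<bullet> v x = (\<Sum>i\<in>UNIV. \<Sum>j\<in>UNIV. v x $ i * (v x $ j * ?G x $ i $ j))" for x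
  proof -
    have "(sym_grad \<Omega> v x *v v x) \<bullet> v x =
        (\<Sum>i\<in>UNIV. \<Sum>j\<in>UNIV. 1/2 * (v x $ i * (v x $ j * ?G x $ i $ j)))
        + (\<Sum>i\<in>UNIV. \<Sum>j\<in>UNIV. 1/2 * (v x $ i * (v x $ j * ?G x $ j $ i)))"
      by (simp add: sym_grad_def inner_vec_def matrix_vector_mult_def transpose_def sum_distrib_left
          sum_distrib_right algebra_simps flip: sum.distrib)
    \<comment> \<open>Exchanging the names of the indices identifies the transposed half with the
      first, since the product of the two velocity components is symmetric.\<close>
    also have "(\<Sum>i\<in>UNIV. \<Sum>j\<in>UNIV. 1/2 * (v x $ i * (v x $ j * ?G x $ j $ i))) =
        (\<Sum>i\<in>UNIV. \<Sum>j\<in>UNIV. 1/2 * (v x $ i * (v x $ j * ?G x $ i $ j)))"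
      by (subst sum.swap) (simp add: mult_ac)
    finally show ?thesis by (simp flip: sum_divide_distrib)
  qed
  have div: "(divergence \<Omega> v x *\<^sub>R v x) \<bullet> v x =
      (\<Sum>i\<in>UNIV. \<Sum>j\<in>UNIV. v x $ i * (v x $ i * ?G x $ j $ j))" for x
    by (simp add: divergence_def trace_def inner_vec_def sum_distrib_left sum_distrib_right mult_ac)
  have "emac \<Omega> v v v = (\<Sum>i\<in>UNIV. \<Sum>j\<in>UNIV.
      2 * L2_inner \<Omega> (\<lambda>x. v x $ i) (\<lambda>x. v x $ j * ?G x $ i $ j)
      + L2_inner \<Omega> (\<lambda>x. v x $ i) (\<lambda>x. v x $ i * ?G x $ j $ j))"
    unfolding emac_def L2_inner_def sym div
    by (simp add: int Bochner_Integration.integral_sum Bochner_Integration.integrable_sum sum.distrib sum_distrib_left)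
  also have "\<dots> = 0"
    using H10_convection[OF assms] by simp
  finally show ?thesis .
qed

section \<open>The dual norm and vanishing velocities\<close>

lemma Hm1_le:
  assumes "F \<in> Hm1 \<Omega>" "v \<in> H10 \<Omega>" "\<not> L2_zero \<Omega> v"
  shows "F v \<le> Hm1_norm \<Omega> F * L2_norm \<Omega> (grad \<Omega> v)"
proof -
  obtain C where C: "\<And>v. v \<in> H10 \<Omega> \<Longrightarrow> \<bar>F v\<bar> \<le> C * L2_norm \<Omega> (grad \<Omega> v)"
    using assms(1) unfolding Hm1_def by blast
  \<comment> \<open>A real supremum bounds its elements only if the set is bounded above. The
    absolute value is taken because a quotient with zero denominator is 0 and must be covered
    too.\<close>
  have "F w / L2_norm \<Omega> (grad \<Omega> w) \<le> \<bar>C\<bar>" if "w \<in> H10 \<Omega>" for w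
  proof (cases "L2_norm \<Omega> (grad \<Omega> w) = 0")
    case False
    then have "0 < L2_norm \<Omega> (grad \<Omega> w)" using L2_norm_nonneg[of \<Omega> "grad \<Omega> w"] by simp
    moreover from this have "C * L2_norm \<Omega> (grad \<Omega> w) \<le> \<bar>C\<bar> * L2_norm \<Omega> (grad \<Omega> w)"
      by (intro mult_right_mono) auto
    moreover have "F w \<le> C * L2_norm \<Omega> (grad \<Omega> w)" using C[OF that] by simp
    ultimately show ?thesis using divide_le_eq order_trans by fastforce
  qed simp
  then have "bdd_above ((\<lambda>v. F v / L2_norm \<Omega> (grad \<Omega> v)) ` {v \<in> H10 \<Omega>. \<not> L2_zero \<Omega> v})"
    by (auto intro!: bdd_aboveI)
  then have le: "F v / L2_norm \<Omega> (grad \<Omega> v) \<le> Hm1_norm \<Omega> F"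
    unfolding Hm1_norm_def using assms by (intro cSUP_upper) auto
  show ?thesis
  proof (cases "L2_norm \<Omega> (grad \<Omega> v) = 0")
    \<comment> \<open>The quotient carries no information here; the continuity bound of
      \<open>F\<close> gives the claim instead.\<close>
    case True
    then show ?thesis using C[OF assms(2)] by simp
  next
    case False
    then have "0 < L2_norm \<Omega> (grad \<Omega> v)" using L2_norm_nonneg[of \<Omega> "grad \<Omega> v"] by simp
    then show ?thesis using le by (simp add: divide_le_eq)
  qed
qed

text \<open>The exceptional set is open and negligible, hence empty. Functionals in
  \<open>Hm1\<close> act on functions rather than on almost-everywhere classes, so pointwise
  vanishing is what permits the conclusion that \<open>F v\<close> is 0.\<close>

lemma L2_zero_continuous:
  fixes v :: "real^'d \<Rightarrow> 'b::euclidean_space"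
  assumes "open \<Omega>" "continuous_on UNIV v" "L2_zero \<Omega> v" "x \<in> \<Omega>"
  shows "v x = 0"
proof (rule ccontr)
  assume "v x \<noteq> 0"
  let ?U = "{y \<in> \<Omega>. v y \<noteq> 0}"
  have eq: "?U = \<Omega> \<inter> v -` (- {0})" by auto
  have "open ?U"
    unfolding eq using assms(1,2) by (intro open_Int open_vimage) auto
  moreover have "negligible ?U"
  proof -
    obtain N where "N \<in> null_sets (lebesgue_on \<Omega>)" "?U \<subseteq> N"
      using assms(3) by (auto simp: L2_zero_def eventually_ae_filter)
    moreover from this have "negligible N"
      using assms(1) by (simp add: null_sets_restrict_space negligible_iff_null_sets)
    ultimately show ?thesis by (blast intro: negligible_subset)
  qed
  ultimately show False
    using \<open>v x \<noteq> 0\<close> assms(4) open_not_negligible by blast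
qed

subsection \<open>Energy stability\<close>

text \<open>The contraction factor 1/3 makes the accumulated right-hand sides a geometric series,
  bounded by the factor 3/2.\<close>

lemma energy_iteration:
  fixes a E s r :: "nat \<Rightarrow> real"
  assumes step: "\<And>n. 1 \<le> n \<Longrightarrow> n < N \<Longrightarrow> E (Suc n) + s n \<le> E n + r n"
    and energy: "\<And>n. n < N \<Longrightarrow> a (Suc n) - a n / 3 \<le> E (Suc n)"
    and nonneg: "\<And>n. 0 \<le> s n" "\<And>n. 0 \<le> r n" "0 \<le> E 1"
  shows "a N + (\<Sum>n = 1..<N. s n) \<le> (1/3) ^ N * a 0 + 3/2 * (E 1 + (\<Sum>n = 1..<N. r n))"
proof -
  have E: "E (Suc n) + (\<Sum>i = 1..<Suc n. s i) \<le> E 1 + (\<Sum>i = 1..<Suc n. r i)" if "n < N" for n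
    using that
  proof (induction n)
    case (Suc n)
    then show ?case using step[of "Suc n"] by simp
  qed simp
  have "a n + (\<Sum>i = 1..<n. s i) \<le> (1/3) ^ n * a 0 + 3/2 * (E 1 + (\<Sum>i = 1..<n. r i))"
    if "n \<le> N" for n
    using that
  proof (induction n)
    case 0
    then show ?case using nonneg by simp
  next
    case (Suc n)
    then have n: "n < N" by simp
    define p B where "p = (1/3) ^ n * a 0" and "B = E 1 + (\<Sum>i = 1..<Suc n. r i)"
    have "a n \<le> a n + (\<Sum>i = 1..<n. s i)" using nonneg by (simp add: sum_nonneg)
    also have "\<dots> \<le> p + 3/2 * (E 1 + (\<Sum>i = 1..<n. r i))"
      using Suc by (simp add: p_def)
    also have "\<dots> \<le> p + 3/2 * B"
      using sum_mono2[of "{1..<Suc n}" "{1..<n}" r] nonneg(2) by (auto simp: B_def)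
    finally have "a (Suc n) + (\<Sum>i = 1..<Suc n. s i) \<le> p / 3 + 3/2 * B"
      using E[OF n, folded B_def] energy[OF n] by linarith
    then show ?case by (simp add: p_def B_def)
  qed
  then show ?thesis by simp
qed

text \<open>The left factor is the BDF2 difference (3x - 4y + z)/2. The constants follow by
  comparing coefficients: E has no x-z term, so the mixed coefficient 3/2 must come from the second
  difference and fixes its weight 3/4; the remaining coefficients then determine E.\<close>

lemma filtered_energy_identity:
  fixes x y z :: "real^'d \<Rightarrow> 'b::euclidean_space"
  assumes "x \<in> L2 \<Omega>" "y \<in> L2 \<Omega>" "z \<in> L2 \<Omega>"
  shows "L2_inner \<Omega> (\<lambda>t. ((3/2) *\<^sub>R x t - y t + (1/2) *\<^sub>R z t) - y t)
      (\<lambda>t. (3/2) *\<^sub>R x t - y t + (1/2) *\<^sub>R z t) =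
    (3/2 * L2_inner \<Omega> x x - 3/2 * L2_inner \<Omega> x y + 1/2 * L2_inner \<Omega> y y)
    - (3/2 * L2_inner \<Omega> y y - 3/2 * L2_inner \<Omega> y z + 1/2 * L2_inner \<Omega> z z)
    + 3/4 * L2_inner \<Omega> (\<lambda>t. x t - 2 *\<^sub>R y t + z t) (\<lambda>t. x t - 2 *\<^sub>R y t + z t)"
proof -
  have pointwise: "(((3/2) *\<^sub>R a - b + (1/2) *\<^sub>R c) - b) \<bullet> ((3/2) *\<^sub>R a - b + (1/2) *\<^sub>R c) =
      (3/2 * (a \<bullet> a) - 3/2 * (a \<bullet> b) + 1/2 * (b \<bullet> b))
      - (3/2 * (b \<bullet> b) - 3/2 * (b \<bullet> c) + 1/2 * (c \<bullet> c))
      + 3/4 * ((a - 2 *\<^sub>R b + c) \<bullet> (a - 2 *\<^sub>R b + c))" for a b c :: 'b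
    by (simp add: inner_add_left inner_add_right inner_diff_left inner_diff_right
        inner_commute[of b a] inner_commute[of c a] inner_commute[of c b] field_simps)
  have "(\<lambda>t. x t - 2 *\<^sub>R y t + z t) \<in> L2 \<Omega>"
    using L2_lincomb[OF L2_lincomb[OF assms(1,2), of 1 "-2"] assms(3), of 1 1] by simp
  note int = L2_inner_integrable[OF this this] L2_inner_integrable[OF assms(1,1)]
    L2_inner_integrable[OF assms(1,2)] L2_inner_integrable[OF assms(2,2)]
    L2_inner_integrable[OF assms(2,3)] L2_inner_integrable[OF assms(3,3)]
  show ?thesis
    unfolding L2_inner_def pointwise
    using int by simp
qed

section \<open>Discrete velocities, the force and the filter\<close>

lemma velocity_space_lincomb:
  assumes "velocity_space \<Omega> \<T> A X" "u \<in> X" "v \<in> X"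
  shows "(\<lambda>x. a *\<^sub>R u x + b *\<^sub>R v x) \<in> X"
proof -
  obtain B where B: "X = {v. \<exists>c. v = (\<lambda>x. \<Sum>b\<in>B. c b *\<^sub>R b x)}"
    using assms(1) unfolding velocity_space_def fe_space_def by blast
  with assms obtain c d where "u = (\<lambda>x. \<Sum>b\<in>B. c b *\<^sub>R b x)" "v = (\<lambda>x. \<Sum>b\<in>B. d b *\<^sub>R b x)"
    by blast
  then have "(\<lambda>x. a *\<^sub>R u x + b *\<^sub>R v x) = (\<lambda>x. \<Sum>e\<in>B. (a * c e + b * d e) *\<^sub>R e x)"
    by (simp add: scaleR_sum_right scaleR_left_distrib sum.distrib)
  then show ?thesis unfolding B by (intro CollectI exI[where x = "\<lambda>e. a * c e + b * d e"])
qed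

lemma nodal_interpolant_in_velocity_space:
  "velocity_space \<Omega> \<T> A X \<Longrightarrow> nodal_interpolant A X w \<in> X"
  using theI'[of "\<lambda>v. v \<in> X \<and> (\<forall>a \<in> A. v a = w a)"]
  by (simp add: velocity_space_def nodal_interpolant_def)

lemma F_norm_squared: "(F_norm \<Omega> w)\<^sup>2 = 3 * L2_inner \<Omega> w w"
  by (simp add: F_norm_def L2_inner_def)

text \<open>Young's inequality weighted by \<open>\<nu>\<close>, so that half of the viscous
  dissipation absorbs the velocity factor. Velocities that vanish almost everywhere are excluded
  from the supremum defining \<open>Hm1_norm\<close> and are treated apart.\<close>

lemma force_le:
  assumes "open \<Omega>" "velocity_space \<Omega> \<T> A X" "v \<in> X" "F \<in> Hm1 \<Omega>" "\<nu> > 0"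
  shows "F v \<le> \<nu> / 2 * (L2_norm \<Omega> (grad \<Omega> v))\<^sup>2 + inverse \<nu> / 2 * (Hm1_norm \<Omega> F)\<^sup>2"
proof (cases "L2_zero \<Omega> v")
  case True
  have v: "v \<in> H10 \<Omega>" "continuous_on UNIV v" "\<And>x. x \<notin> \<Omega> \<Longrightarrow> v x = 0"
    using assms(2,3) by (auto simp: velocity_space_def)
  have "v x = 0" for x
    using L2_zero_continuous[OF assms(1) v(2) True] v(3) by blast
  \<comment> \<open>Continuity inside \<open>\<Omega>\<close> and extension by zero outside make
    \<open>v\<close> the zero function; writing it as a trivial combination lets linearity of
    \<open>F\<close> apply.\<close>
  then have "v = (\<lambda>x. 0 *\<^sub>R v x + 0 *\<^sub>R v x)" by auto
  moreover have "F (\<lambda>x. 0 *\<^sub>R v x + 0 *\<^sub>R v x) = 0 * F v + 0 * F v"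
    using assms(4) v(1) unfolding Hm1_def by blast
  ultimately have "F v = 0" by simp
  then show ?thesis using assms(5) by simp
next
  case False
  have "v \<in> H10 \<Omega>" using assms(2,3) by (auto simp: velocity_space_def)
  define a where "a = L2_norm \<Omega> (grad \<Omega> v)"
  define b where "b = Hm1_norm \<Omega> F"
  have "F v \<le> b * a"
    using Hm1_le[OF assms(4) \<open>v \<in> H10 \<Omega>\<close> False] by (simp add: a_def b_def)
  moreover have "0 \<le> inverse \<nu> / 2 * (b - \<nu> * a)\<^sup>2" using assms(5) by simp
  moreover have "inverse \<nu> / 2 * (b - \<nu> * a)\<^sup>2 = \<nu> / 2 * a\<^sup>2 + inverse \<nu> / 2 * b\<^sup>2 - b * a"
    using assms(5) by (simp add: power2_eq_square field_simps)
  ultimately show ?thesis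
    unfolding a_def[symmetric] b_def[symmetric] by linarith
qed

text \<open>Step 2 is an affine equation for the unfiltered velocity. Solving it eliminates
  \<open>ut\<close> and leaves a two-step method in \<open>u\<close> alone.\<close>

lemma filtered_emac_scheme_eq_filter_F:
  assumes "filtered_emac_scheme \<Omega> X Q \<nu> f dt N u ut P" "0 \<le> n" "n < int N"
  shows "ut (n + 1) = filter_F u (n + 1)"
proof
  fix x
  have "b = (3/2) *\<^sub>R a - c + (1/2) *\<^sub>R d"
    if "a = b - (1/3) *\<^sub>R (b - 2 *\<^sub>R c + d)" for a b c d :: "real^'d"
    unfolding that by (simp add: algebra_simps vec_eq_iff)
  moreover have "u (n + 1) x = ut (n + 1) x - (1/3) *\<^sub>R (ut (n + 1) x - 2 *\<^sub>R u n x + u (n - 1) x)"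
    using assms by (fastforce simp: filtered_emac_scheme_def)
  ultimately have "ut (n + 1) x = (3/2) *\<^sub>R u (n + 1) x - u n x + (1/2) *\<^sub>R u (n - 1) x"
    by blast
  then show "ut (n + 1) x = filter_F u (n + 1) x"
    by (simp add: filter_F_def)
qed

lemma filtered_emac_scheme_in_velocity_space:
  assumes "velocity_space \<Omega> \<T> A X" "filtered_emac_scheme \<Omega> X Q \<nu> f dt N u ut P"
    and "u 0 \<in> X" "u (-1) \<in> X" "n \<le> N"
  shows "u (int n) \<in> X"
proof -
  \<comment> \<open>Step 2 reaches back two levels, so the induction carries two consecutive ones;
    the base case needs \<open>u (-1)\<close>.\<close>
  have "u (int n) \<in> X \<and> u (int n - 1) \<in> X" using assms(5)
  proof (induction n)
    case (Suc n)
    then have "ut (int n + 1) \<in> X" and eq: "u (int n + 1) =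
        (\<lambda>x. ut (int n + 1) x - (1/3) *\<^sub>R (ut (int n + 1) x - 2 *\<^sub>R u (int n) x + u (int n - 1) x))"
      using assms(2) by (auto simp: filtered_emac_scheme_def)
    then have "(\<lambda>x. 1 *\<^sub>R ((2/3) *\<^sub>R ut (int n + 1) x + (2/3) *\<^sub>R u (int n) x) + (-1/3) *\<^sub>R u (int n - 1) x) \<in> X"
      using Suc by (intro velocity_space_lincomb[OF assms(1)]) auto
    also have "(\<lambda>x. 1 *\<^sub>R ((2/3) *\<^sub>R ut (int n + 1) x + (2/3) *\<^sub>R u (int n) x) + (-1/3) *\<^sub>R u (int n - 1) x)
        = u (int n + 1)"
      unfolding eq by (auto simp: algebra_simps vec_eq_iff)
    finally show ?case using Suc by (simp add: add.commute)
  qed (use assms in simp)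
  then show ?thesis by simp
qed

lemma filtered_emac_energy_step:
  assumes "bounded \<Omega>" "open \<Omega>" "velocity_space \<Omega> \<T> A X"
    and scheme: "filtered_emac_scheme \<Omega> X Q \<nu> f dt N u ut P"
    and n: "0 \<le> n" "n < int N"
    and X: "u (n + 1) \<in> X" "u n \<in> X" "u (n - 1) \<in> X"
    and f: "f (real_of_int (n + 1) * dt) \<in> Hm1 \<Omega>" and pos: "\<nu> > 0" "dt > 0"
  shows "(3/2 * L2_inner \<Omega> (u (n + 1)) (u (n + 1)) - 3/2 * L2_inner \<Omega> (u (n + 1)) (u n)
      + 1/2 * L2_inner \<Omega> (u n) (u n))
    + 3/4 * L2_inner \<Omega> (\<lambda>x. u (n + 1) x - 2 *\<^sub>R u n x + u (n - 1) x)
        (\<lambda>x. u (n + 1) x - 2 *\<^sub>R u n x + u (n - 1) x)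
    + dt * \<nu> / 2 * (L2_norm \<Omega> (grad \<Omega> (filter_F u (n + 1))))\<^sup>2
    \<le> (3/2 * L2_inner \<Omega> (u n) (u n) - 3/2 * L2_inner \<Omega> (u n) (u (n - 1))
      + 1/2 * L2_inner \<Omega> (u (n - 1)) (u (n - 1)))
    + dt * inverse \<nu> / 2 * (Hm1_norm \<Omega> (f (real_of_int (n + 1) * dt)))\<^sup>2"
proof -
  let ?U = "filter_F u (n + 1)" and ?F = "f (real_of_int (n + 1) * dt)"
  have U: "ut (n + 1) = ?U"
    by (rule filtered_emac_scheme_eq_filter_F[OF scheme n])
  have in_X: "?U \<in> X" and P: "P (n + 1) \<in> Q"
    and div: "\<And>q. q \<in> Q \<Longrightarrow> L2_inner \<Omega> (divergence \<Omega> ?U) q = 0"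
    and eq: "L2_inner \<Omega> (\<lambda>x. (1 / dt) *\<^sub>R (?U x - u n x)) ?U
           + \<nu> * L2_inner \<Omega> (grad \<Omega> ?U) (grad \<Omega> ?U) + emac \<Omega> ?U ?U ?U
           - L2_inner \<Omega> (P (n + 1)) (divergence \<Omega> ?U) = ?F ?U"
    using scheme n unfolding filtered_emac_scheme_def U[symmetric] by auto
  have L2: "v \<in> L2 \<Omega>" if "v \<in> X" for v
    using assms(3) that by (auto simp: velocity_space_def H10_def H1_def)
  have "emac \<Omega> ?U ?U ?U = 0"
    using assms(3) in_X by (intro emac_self_eq_0 assms(1,2)) (auto simp: velocity_space_def)
  moreover have "L2_inner \<Omega> (P (n + 1)) (divergence \<Omega> ?U) = 0"
    using div[OF P] L2_inner_commute by metis
  moreover have "L2_inner \<Omega> (\<lambda>x. (1 / dt) *\<^sub>R (?U x - u n x)) ?U = L2_inner \<Omega> (\<lambda>x. ?U x - u n x) ?U / dt"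
    by (simp add: L2_inner_def)
  \<comment> \<open>Of the full viscous term, half is spent on the force.\<close>
  ultimately have "L2_inner \<Omega> (\<lambda>x. ?U x - u n x) ?U / dt + \<nu> / 2 * (L2_norm \<Omega> (grad \<Omega> ?U))\<^sup>2
      \<le> inverse \<nu> / 2 * (Hm1_norm \<Omega> ?F)\<^sup>2"
    using eq force_le[OF assms(2,3) in_X f pos(1)] unfolding L2_norm_squared by linarith
  from mult_left_mono[OF this, of dt]
  have "L2_inner \<Omega> (\<lambda>x. ?U x - u n x) ?U + dt * \<nu> / 2 * (L2_norm \<Omega> (grad \<Omega> ?U))\<^sup>2
      \<le> dt * inverse \<nu> / 2 * (Hm1_norm \<Omega> ?F)\<^sup>2"
    using pos by (simp add: distrib_left)
  moreover have "?U = (\<lambda>x. (3/2) *\<^sub>R u (n + 1) x - u n x + (1/2) *\<^sub>R u (n - 1) x)"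
    by (auto simp: filter_F_def)
  then have "L2_inner \<Omega> (\<lambda>x. ?U x - u n x) ?U =
      L2_inner \<Omega> (\<lambda>x. ((3/2) *\<^sub>R u (n + 1) x - u n x + (1/2) *\<^sub>R u (n - 1) x) - u n x)
        (\<lambda>x. (3/2) *\<^sub>R u (n + 1) x - u n x + (1/2) *\<^sub>R u (n - 1) x)"
    by simp
  ultimately show ?thesis
    using filtered_energy_identity[OF L2[OF X(1)] L2[OF X(2)] L2[OF X(3)]] by linarith
qed

lemma sum_int_interval: "(\<Sum>n = 1..int N - 1. g n) = (\<Sum>n = 1..<N. g (int n))"
  by (rule sum.reindex_bij_witness[of _ int nat]) auto

theorem lemma5p1:
  fixes \<Omega> :: "(real^'d) set"
    and \<T> :: "(real^'d) set set" and A :: "(real^'d) set" and \<sigma> h \<beta>0 :: real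
    and X :: "(real^'d \<Rightarrow> real^'d) set" and Q :: "(real^'d \<Rightarrow> real) set"
    and \<nu> T dt :: real and N :: nat
    and f :: "real \<Rightarrow> (real^'d \<Rightarrow> real^'d) \<Rightarrow> real"
    and u0 :: "real^'d \<Rightarrow> real^'d"
    and u ut :: "int \<Rightarrow> real^'d \<Rightarrow> real^'d" and P :: "int \<Rightarrow> real^'d \<Rightarrow> real"
  assumes dim: "CARD('d) = 2 \<or> CARD('d) = 3"
    and domain: "convex_polytopal_domain \<Omega>"
    and mesh: "regular_mesh \<Omega> \<sigma> h \<T>"
    and velocity: "velocity_space \<Omega> \<T> A X"
    and pressure: "pressure_space \<Omega> \<T> Q"
    and inf_sup: "\<beta>0 > 0" "discrete_inf_sup \<Omega> X Q \<beta>0"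
    and viscosity: "\<nu> > 0"
    and time: "N \<ge> 1" "dt > 0" "dt = T / real N"
    and force: "f \<in> Linf_Hm1 \<Omega> T" "\<forall>n \<in> {1..N}. f (real n * dt) \<in> Hm1 \<Omega>"
    and initial: "u 0 = nodal_interpolant A X u0" "u (-1) = nodal_interpolant A X u0"
    and scheme: "filtered_emac_scheme \<Omega> X Q \<nu> f dt N u ut P"
  shows
    "(L2_norm \<Omega> (u (int N)))\<^sup>2
     + 1/3 * (\<Sum>n = 1..int N - 1. (F_norm \<Omega> (\<lambda>x. u (n + 1) x - 2 *\<^sub>R u n x + u (n - 1) x))\<^sup>2)
     + 2 * dt * \<nu> / 3 * (\<Sum>n = 1..int N - 1. (L2_norm \<Omega> (grad \<Omega> (filter_F u (n + 1))))\<^sup>2)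
     \<le> (1/3) ^ N * (L2_norm \<Omega> (u 0))\<^sup>2
       + 2 * real N * ((L2_norm \<Omega> (u 1))\<^sup>2 + (L2_norm \<Omega> (u 0))\<^sup>2)
       + 2 * real N * dt * inverse \<nu> / 3
         * (\<Sum>n = 1..int N - 1. (Hm1_norm \<Omega> (f (real_of_int (n + 1) * dt)))\<^sup>2)"
proof -
  have dom: "bounded \<Omega>" "open \<Omega>" using domain by (auto simp: convex_polytopal_domain_def)
  have X0: "u 0 \<in> X" "u (-1) \<in> X"
    using nodal_interpolant_in_velocity_space[OF velocity] initial by auto
  note in_X = filtered_emac_scheme_in_velocity_space[OF velocity scheme X0]
  have L2: "u (int n) \<in> L2 \<Omega>" if "n \<le> N" for n
    using velocity in_X[OF that] by (auto simp: velocity_space_def H10_def H1_def)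
  define a where "a n = L2_inner \<Omega> (u (int n)) (u (int n))" for n
  define b where "b n = L2_inner \<Omega> (u (int n)) (u (int n - 1))" for n
  \<comment> \<open>The energy of the identity times 4/3, which turns the weight 3/4 of the second
    difference into 1 (the third of its squared F-norm) and \<open>dt * \<nu> / 2\<close> into the
    stated viscous coefficient. It is used for n >= 1 only, where \<open>n - 1\<close> is a true
    predecessor.\<close>
  define E where "E n = 2 * a n - 2 * b n + 2/3 * a (n - 1)" for n
  define d where "d n = L2_inner \<Omega> (\<lambda>x. u (int n + 1) x - 2 *\<^sub>R u (int n) x + u (int n - 1) x)
    (\<lambda>x. u (int n + 1) x - 2 *\<^sub>R u (int n) x + u (int n - 1) x)" for n
  define g where "g n = (L2_norm \<Omega> (grad \<Omega> (filter_F u (int n + 1))))\<^sup>2" for n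
  define r where "r n = (Hm1_norm \<Omega> (f (real_of_int (int n + 1) * dt)))\<^sup>2" for n
  have quad: "0 \<le> s\<^sup>2 * a (Suc n) + 2 * s * t * b (Suc n) + t\<^sup>2 * a n" if "n < N" for n s t
    using L2_inner_quadratic_nonneg[OF L2[of "Suc n"] L2[of n], of s t] that
    by (simp add: a_def b_def)
  have main: "a N + (\<Sum>n = 1..<N. d n + 2 * dt * \<nu> / 3 * g n)
      \<le> (1/3) ^ N * a 0 + 3/2 * (E 1 + (\<Sum>n = 1..<N. 2 * dt * inverse \<nu> / 3 * r n))"
  proof (rule energy_iteration)
    fix n assume n: "1 \<le> n" "n < N"
    then have X: "u (int n + 1) \<in> X" "u (int n) \<in> X" "u (int n - 1) \<in> X"
      using in_X[of "n + 1"] in_X[of n] in_X[of "n - 1"] by (simp_all add: of_nat_diff add.commute)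
    have "f (real_of_int (int n + 1) * dt) \<in> Hm1 \<Omega>"
      using force(2)[rule_format, of "n + 1"] n by (simp add: add.commute)
    from filtered_emac_energy_step[OF dom velocity scheme _ _ X this viscosity time(2)] n
    have "(3/2 * a (Suc n) - 3/2 * b (Suc n) + 1/2 * a n) + 3/4 * d n + dt * \<nu> / 2 * g n
        \<le> (3/2 * a n - 3/2 * b n + 1/2 * a (n - 1)) + dt * inverse \<nu> / 2 * r n"
      by (simp add: a_def b_def d_def g_def r_def of_nat_diff add.commute)
    then show "E (Suc n) + (d n + 2 * dt * \<nu> / 3 * g n) \<le> E n + 2 * dt * inverse \<nu> / 3 * r n"
      by (simp add: E_def)
  next
    fix n assume "n < N"
    from quad[OF this, of 1 "-1"] show "a (Suc n) - a n / 3 \<le> E (Suc n)"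
      by (simp add: E_def)
  next
    fix n show "0 \<le> d n + 2 * dt * \<nu> / 3 * g n"
      using time(2) viscosity by (simp add: d_def g_def L2_inner_self_nonneg)
    show "0 \<le> 2 * dt * inverse \<nu> / 3 * r n"
      using time(2) viscosity by (simp add: r_def)
  next
    show "0 \<le> E 1"
      \<comment> \<open>\<open>E 1\<close> is 2 |u^1 - u^0/2|^2 + |u^0|^2/6.\<close>
      using quad[of 0 1 "-1/2"] time(1) L2_inner_self_nonneg[of \<Omega> "u 0"]
      by (simp add: E_def a_def power2_eq_square)
  qed
  have nonneg: "0 \<le> a 1" "0 \<le> a 0" by (simp_all add: a_def L2_inner_self_nonneg)
  have "a N + (\<Sum>n = 1..<N. d n) + 2 * dt * \<nu> / 3 * (\<Sum>n = 1..<N. g n)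
      \<le> (1/3) ^ N * a 0 + 2 * real N * (a 1 + a 0) + 2 * real N * dt * inverse \<nu> / 3 * (\<Sum>n = 1..<N. r n)"
  \<comment> \<open>For \<open>N = 1\<close> the sums are empty and \<open>a 1\<close> is already on
    the right. Otherwise N >= 2 yields both 4 <= 2N for the data and 3/2 <= N for the force.\<close>
  proof (cases "N = 1")
    case True
    then show ?thesis using nonneg by simp
  next
    case False
    then have N: "2 \<le> real N" using time(1) by simp
    have "3/2 * E 1 \<le> 4 * (a 1 + a 0)"
      \<comment> \<open>Nonnegativity of |u^1 + 3/2 u^0|^2 bounds -3 (u^1, u^0) by |u^1|^2 + 9/4
        |u^0|^2, so 3/2 \<open>E 1\<close> is at most 4 |u^1|^2 + 13/4 |u^0|^2.\<close>
      using quad[of 0 1 "3/2"] time(1) nonneg by (simp add: E_def power2_eq_square)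
    also have "\<dots> \<le> 2 * real N * (a 1 + a 0)"
      using N nonneg by (intro mult_right_mono) auto
    finally have "3/2 * E 1 \<le> 2 * real N * (a 1 + a 0)" .
    moreover define R where "R = 2 * dt * inverse \<nu> / 3 * (\<Sum>n = 1..<N. r n)"
    have "0 \<le> R" using time(2) viscosity by (simp add: R_def r_def sum_nonneg)
    then have "3/2 * R \<le> real N * R" using N by (intro mult_right_mono) auto
    moreover have "real N * R = 2 * real N * dt * inverse \<nu> / 3 * (\<Sum>n = 1..<N. r n)"
      by (simp add: R_def)
    moreover have "a N + (\<Sum>n = 1..<N. d n) + 2 * dt * \<nu> / 3 * (\<Sum>n = 1..<N. g n)
        \<le> (1/3) ^ N * a 0 + 3/2 * E 1 + 3/2 * R"
      using main unfolding R_def sum.distrib sum_distrib_left[symmetric] distrib_left by simp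
    ultimately show ?thesis by linarith
  qed
  then show ?thesis
    unfolding sum_int_interval F_norm_squared L2_norm_squared[of \<Omega> "u (int N)"]
      L2_norm_squared[of \<Omega> "u 0"] L2_norm_squared[of \<Omega> "u 1"]
    by (simp add: a_def d_def g_def r_def flip: sum_distrib_left)
qed

end
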